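(* Let $G$ be a finite, simple, connected graph on $n$ vertices, let $\overline{G}$ be its complement, and let $G\cup\overline{G}$ (which is $K_n$) be their union on the common vertex set. Then $\sigma^-(G)+\sigma^-(\overline{G})\le\sigma^-(G\cup\overline{G})$, and equality holds if and only if $G$ is $K_{1,n-1}$ with $n$ even, or $K_n$.
   Context: For a finite simple graph $H$ on $n$ vertices (not necessarily connected), a parity-signature of $H$ is a map $\sigma:E(H)\to\{1,-1\}$ for which there is a partition $V(H)=V_1\cup V_2$ with $||V_1|-|V_2||\le1$ such that an edge has sign $-1$ (is negative) exactly when its ends lie in different sets. $\sigma^-(H)$ (the $rna$ number) is the minimum number of negative edges over all parity-signatures of $H$. *)

theory Defs
  imports "Graph_Theory.Graph_Theory"
begin

text \<open>
  A finite simple graph is a \<^locale>\<open>pair_graph\<close>: a finite, loop-free, symmetric digraph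
  whose arcs are ordered pairs of vertices.  An undirected edge \<open>{u, v}\<close> is thus represented by
  the two arcs \<open>(u, v)\<close> and \<open>(v, u)\<close>; signatures live on, and the rna number counts,
  the undirected edges.
\<close>

definition edges :: "('a, 'b) pre_digraph \<Rightarrow> 'a set set" where
  "edges H = {{u, v} | u v. (u, v) \<in> arcs_ends H}"

definition parity_signature :: "('a, 'b) pre_digraph \<Rightarrow> ('a set \<Rightarrow> int) \<Rightarrow> bool" where
  "parity_signature H \<sigma> \<longleftrightarrow>
     \<sigma> \<in> edges H \<rightarrow> {1, - 1} \<and>
     (\<exists>V\<^sub>1 V\<^sub>2. V\<^sub>1 \<union> V\<^sub>2 = verts H \<and> V\<^sub>1 \<inter> V\<^sub>2 = {} \<and>
        \<bar>int (card V\<^sub>1) - int (card V\<^sub>2)\<bar> \<le> 1 \<and>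
        (\<forall>e \<in> edges H. \<sigma> e = - 1 \<longleftrightarrow> (\<exists>u \<in> V\<^sub>1. \<exists>v \<in> V\<^sub>2. e = {u, v})))"

definition negative_edges :: "('a, 'b) pre_digraph \<Rightarrow> ('a set \<Rightarrow> int) \<Rightarrow> 'a set set" where
  "negative_edges H \<sigma> = {e \<in> edges H. \<sigma> e = - 1}"

definition rna :: "('a, 'b) pre_digraph \<Rightarrow> nat" where
  "rna H = Min {card (negative_edges H \<sigma>) | \<sigma>. parity_signature H \<sigma>}"

definition complement :: "'a pair_pre_digraph \<Rightarrow> 'a pair_pre_digraph" where
  "complement G = \<lparr> pverts = pverts G,
     parcs = {(u, v). u \<in> pverts G \<and> v \<in> pverts G \<and> u \<noteq> v \<and> (u, v) \<notin> parcs G} \<rparr>"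

text \<open>The minimum in \<^const>\<open>rna\<close> is taken over a finite nonempty set.\<close>

lemma finite_edges:
  assumes "fin_digraph H"
  shows "finite (edges H)"
proof -
  interpret fin_digraph H by fact
  have "edges H = (\<lambda>(u, v). {u, v}) ` arcs_ends H"
    by (auto simp: edges_def image_iff split: prod.splits)
  then show ?thesis
    by (simp add: arcs_ends_def)
qed

lemma finite_rna_set:
  assumes "fin_digraph H"
  shows "finite {card (negative_edges H \<sigma>) | \<sigma>. parity_signature H \<sigma>}"
proof (rule finite_subset)
  show "{card (negative_edges H \<sigma>) | \<sigma>. parity_signature H \<sigma>} \<subseteq> {..card (edges H)}"
    using finite_edges[OF assms] by (auto simp: negative_edges_def intro: card_mono)
qed simp

lemma rna_set_nonempty:
  assumes "fin_digraph H"
  shows "{card (negative_edges H \<sigma>) | \<sigma>. parity_signature H \<sigma>} \<noteq> {}"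
proof -
  interpret fin_digraph H by fact
  obtain V where V: "V \<subseteq> verts H" "card V = card (verts H) div 2"
    by (meson div_le_dividend obtain_subset_with_card_n)
  define \<sigma> :: "'a set \<Rightarrow> int"
    where "\<sigma> e = (if \<exists>u \<in> V. \<exists>v \<in> verts H - V. e = {u, v} then - 1 else 1)" for e
  have "card (verts H - V) = card (verts H) - card (verts H) div 2"
    using V by (simp add: card_Diff_subset finite_subset[OF V(1)])
  then have "\<bar>int (card V) - int (card (verts H - V))\<bar> \<le> 1"
    using V(2) by linarith
  moreover have "V \<union> (verts H - V) = verts H" "V \<inter> (verts H - V) = {}"
    using V by auto
  moreover have "\<forall>e \<in> edges H. \<sigma> e = - 1 \<longleftrightarrow> (\<exists>u \<in> V. \<exists>v \<in> verts H - V. e = {u, v})"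
    by (simp add: \<sigma>_def)
  moreover have "\<sigma> \<in> edges H \<rightarrow> {1, - 1}"
    by (simp add: \<sigma>_def)
  ultimately have "parity_signature H \<sigma>"
    unfolding parity_signature_def by blast
  then show ?thesis by blast
qed

lemma pair_graph_complement:
  assumes "pair_graph G"
  shows "pair_graph (complement G)"
proof -
  interpret pair_graph G by fact
  have fin: "finite (parcs (complement G))"
    by (rule finite_subset[of _ "pverts G \<times> pverts G"]) (auto simp: complement_def)
  have sym: "sym (parcs G)"
    using sym_arcs by (simp add: symmetric_def)
  show ?thesis
    by unfold_locales
      (use fin sym in \<open>auto simp: complement_def symmetric_def intro!: symI dest: symD\<close>)
qed

lemma complete_union_complement:
  assumes "pair_graph G"
  shows "K\<^bsub>card (pverts G)\<^esub> (Digraph_Component.union (with_proj G) (with_proj (complement G)))"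
proof -
  interpret pair_graph G by fact
  let ?K = "\<lparr> pverts = pverts G, parcs = {(u, v). (u, v) \<in> pverts G \<times> pverts G \<and> u \<noteq> v} \<rparr>"
  have "Digraph_Component.union (with_proj G) (with_proj (complement G)) = with_proj ?K"
    using in_arcsD1 in_arcsD2
    by (auto dest: no_loops' simp: Digraph_Component.union_def with_proj_def complement_def)
  then show ?thesis
    using finite_verts by (simp add: complete_digraph_pair_def)
qed

end

theory Submission
  imports Defs
begin

text \<open>
  A signature is determined by a balanced bipartition, so the rna number is the least size of a
  balanced cut.  A balanced cut of \<open>G\<close> and the same cut of the complement together make up
  \<open>\<lfloor>n/2\<rfloor>\<lceil>n/2\<rceil>\<close> edges, a constant; hence the inequality, with equality iff all balanced cuts of
  \<open>G\<close> have the same size.  Adding a vertex \<open>x\<close> to a side \<open>S\<close> changes the cut by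
  \<open>deg x - 2 |N(x) \<inter> S|\<close>.  For odd \<open>n\<close> moving one vertex to the other side thus forces every vertex
  to be isolated or universal.  For even \<open>n\<close> exchanging \<open>u\<close> and \<open>v\<close> forces the difference of the
  adjacency rows of \<open>u\<close> and \<open>v\<close> to be constant off \<open>{u, v}\<close>, which for a connected graph leaves
  only the complete graph and the star.
\<close>

definition cut_size :: "('a, 'b) pre_digraph \<Rightarrow> 'a set \<Rightarrow> nat" where
  "cut_size H S = card (arcs_ends H \<inter> S \<times> (verts H - S))"

definition balanced :: "'a set \<Rightarrow> 'a set \<Rightarrow> bool" where
  "balanced V S \<longleftrightarrow> S \<subseteq> V \<and> \<bar>int (card S) - int (card (V - S))\<bar> \<le> 1"

lemma balanced_iff_card:
  assumes "finite V"
  shows "balanced V S \<longleftrightarrow>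
    S \<subseteq> V \<and> (card S = card V div 2 \<or> card S = card V - card V div 2)"
proof (cases "S \<subseteq> V")
  case True
  then have "card (V - S) = card V - card S" "card S \<le> card V"
    using assms by (auto simp: card_Diff_subset finite_subset card_mono)
  with True show ?thesis
    unfolding balanced_def by auto
qed (simp add: balanced_def)

lemma card_negative_edges_eq_cut:
  assumes "graph H" "S \<subseteq> verts H"
    and neg: "\<And>e. e \<in> edges H \<Longrightarrow> \<sigma> e = - 1 \<longleftrightarrow> (\<exists>u \<in> S. \<exists>v \<in> verts H - S. e = {u, v})"
  shows "card (negative_edges H \<sigma>) = cut_size H S"
proof -
  interpret graph H by fact
  let ?C = "arcs_ends H \<inter> S \<times> (verts H - S)"
  have sym: "(v, u) \<in> arcs_ends H" if "(u, v) \<in> arcs_ends H" for u v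
    using arcs_ends_symmetric[OF sym_arcs that] .
  have "negative_edges H \<sigma> = (\<lambda>(u, v). {u, v}) ` ?C"
  proof (intro equalityI subsetI)
    fix e assume e: "e \<in> negative_edges H \<sigma>"
    then have "e \<in> edges H" "\<sigma> e = - 1" by (auto simp: negative_edges_def)
    with neg obtain u v where uv: "u \<in> S" "v \<in> verts H - S" "e = {u, v}" by auto
    with \<open>e \<in> edges H\<close> have "(u, v) \<in> arcs_ends H"
      by (auto simp: edges_def doubleton_eq_iff intro: sym)
    with uv show "e \<in> (\<lambda>(u, v). {u, v}) ` ?C" by auto
  next
    fix e assume "e \<in> (\<lambda>(u, v). {u, v}) ` ?C"
    then obtain u v where uv: "(u, v) \<in> arcs_ends H" "u \<in> S" "v \<in> verts H - S" "e = {u, v}"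
      by auto
    then have "e \<in> edges H" by (auto simp: edges_def)
    with neg uv show "e \<in> negative_edges H \<sigma>" unfolding negative_edges_def by blast
  qed
  moreover have "inj_on (\<lambda>(u, v). {u, v}) ?C"
    by (auto simp: inj_on_def doubleton_eq_iff)
  ultimately show ?thesis
    by (simp add: cut_size_def card_image)
qed

lemma rna_set_eq_cuts:
  assumes "graph H"
  shows "{card (negative_edges H \<sigma>) | \<sigma>. parity_signature H \<sigma>} = cut_size H ` {S. balanced (verts H) S}"
proof (intro equalityI subsetI)
  fix m assume "m \<in> {card (negative_edges H \<sigma>) | \<sigma>. parity_signature H \<sigma>}"
  then obtain \<sigma> where m: "m = card (negative_edges H \<sigma>)" and "parity_signature H \<sigma>" by blast
  then obtain S T where ST: "S \<union> T = verts H" "S \<inter> T = {}" "\<bar>int (card S) - int (card T)\<bar> \<le> 1"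
    and neg: "\<forall>e\<in>edges H. \<sigma> e = - 1 \<longleftrightarrow> (\<exists>u \<in> S. \<exists>v \<in> T. e = {u, v})"
    unfolding parity_signature_def by (elim conjE exE) (rule that)
  from ST have T: "T = verts H - S" and S: "S \<subseteq> verts H" by auto
  have "m = cut_size H S"
    unfolding m using assms S bspec[OF neg, unfolded T] by (rule card_negative_edges_eq_cut)
  moreover have "balanced (verts H) S"
    using ST(3) S unfolding T balanced_def by blast
  ultimately show "m \<in> cut_size H ` {S. balanced (verts H) S}" by blast
next
  fix m assume "m \<in> cut_size H ` {S. balanced (verts H) S}"
  then obtain S where m: "m = cut_size H S" and S: "balanced (verts H) S" by blast
  define \<sigma> :: "'a set \<Rightarrow> int"
    where "\<sigma> e = (if \<exists>u \<in> S. \<exists>v \<in> verts H - S. e = {u, v} then - 1 else 1)" for e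
  have neg: "\<sigma> e = - 1 \<longleftrightarrow> (\<exists>u \<in> S. \<exists>v \<in> verts H - S. e = {u, v})" for e
    by (simp add: \<sigma>_def)
  have SV: "S \<subseteq> verts H" "\<bar>int (card S) - int (card (verts H - S))\<bar> \<le> 1"
    using S by (auto simp: balanced_def)
  have "parity_signature H \<sigma>"
    unfolding parity_signature_def
  proof (intro conjI exI ballI)
    show "\<sigma> \<in> edges H \<rightarrow> {1, - 1}" by (simp add: \<sigma>_def)
    show "S \<union> (verts H - S) = verts H" "S \<inter> (verts H - S) = {}" using SV(1) by auto
  qed (rule SV(2) neg)+
  moreover have "m = card (negative_edges H \<sigma>)"
    unfolding m using assms SV(1) neg by (rule card_negative_edges_eq_cut[symmetric])
  ultimately show "m \<in> {card (negative_edges H \<sigma>) | \<sigma>. parity_signature H \<sigma>}" by blast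
qed

lemma rna_le_cut:
  assumes "graph H" "balanced (verts H) S"
  shows "rna H \<le> cut_size H S"
proof -
  interpret graph H by fact
  have "finite (cut_size H ` {S. balanced (verts H) S})"
    using finite_rna_set[of H] rna_set_eq_cuts[OF assms(1)] fin_digraph_axioms by simp
  then show ?thesis
    using assms by (simp add: rna_def rna_set_eq_cuts)
qed

lemma rna_attained:
  assumes "graph H"
  obtains S where "balanced (verts H) S" "rna H = cut_size H S"
proof -
  interpret graph H by fact
  have "rna H \<in> cut_size H ` {S. balanced (verts H) S}"
    unfolding rna_def rna_set_eq_cuts[OF assms, symmetric]
    using finite_rna_set rna_set_nonempty fin_digraph_axioms by (intro Min_in) auto
  then show thesis using that by auto
qed

lemma balanced_cut_complete:
  assumes K: "K\<^bsub>n\<^esub> H" and S: "balanced (verts H) S"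
  shows "cut_size H S = (n div 2) * (n - n div 2)"
proof -
  interpret graph H using K by (simp add: complete_digraph_def)
  have ends: "arcs_ends H = {(u, v). (u, v) \<in> verts H \<times> verts H \<and> u \<noteq> v}"
    and n: "card (verts H) = n"
    using K by (simp_all add: complete_digraph_def)
  have SV: "S \<subseteq> verts H" "card S = n div 2 \<or> card S = n - n div 2"
    using S n by (simp_all add: balanced_iff_card)
  have "arcs_ends H \<inter> S \<times> (verts H - S) = S \<times> (verts H - S)"
    using SV by (auto simp: ends)
  then have "cut_size H S = card S * (n - card S)"
    using SV n by (simp add: cut_size_def card_cartesian_product card_Diff_subset finite_subset)
  with SV(2) show ?thesis by auto
qed

lemma equal_if_subset_sums_equal:
  fixes g :: "'b \<Rightarrow> int"
  assumes "finite R" "0 < m" "m < card R"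
    and sums: "\<And>T. T \<subseteq> R \<Longrightarrow> card T = m \<Longrightarrow> sum g T = c"
    and xy: "x \<in> R" "y \<in> R"
  shows "g x = g y"
proof (cases "x = y")
  case False
  have "card (R - {x, y}) = card R - card {x, y}"
    using xy by (intro card_Diff_subset) auto
  then have "m - 1 \<le> card (R - {x, y})"
    using assms(2,3) False by simp
  then obtain T where T: "T \<subseteq> R - {x, y}" "card T = m - 1"
    by (metis obtain_subset_with_card_n)
  have "finite T" "x \<notin> T" "y \<notin> T"
    using T \<open>finite R\<close> by (auto intro: finite_subset)
  then have "card (insert x T) = m" "card (insert y T) = m"
    using T \<open>0 < m\<close> by simp_all
  then have "sum g (insert x T) = c" "sum g (insert y T) = c"
    using T xy by (auto intro!: sums)
  moreover have "sum g (insert x T) = g x + sum g T" "sum g (insert y T) = g y + sum g T"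
    using \<open>finite T\<close> \<open>x \<notin> T\<close> \<open>y \<notin> T\<close> by simp_all
  ultimately show ?thesis by simp
qed simp

context pair_graph
begin

abbreviation adj :: "'a \<Rightarrow> 'a \<Rightarrow> int" where
  "adj u v \<equiv> of_bool ((u, v) \<in> parcs G)"

lemma adj_sym: "adj u v = adj v u"
  using arcs_symmetric[of u v] arcs_symmetric[of v u] by auto

lemma cut_eq_sum:
  assumes "S \<subseteq> pverts G"
  shows "int (cut_size (with_proj G) S) = (\<Sum>u\<in>S. \<Sum>v\<in>pverts G - S. adj u v)"
proof -
  have fin: "finite S" "finite (pverts G - S)"
    using finite_subset[OF assms(1) finite_verts] finite_verts by simp_all
  have "(\<Sum>u\<in>S. \<Sum>v\<in>pverts G - S. adj u v) =
      (\<Sum>p\<in>S \<times> (pverts G - S). of_bool (p \<in> parcs G))"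
    by (subst sum.cartesian_product) (auto intro!: sum.cong)
  also have "\<dots> = int (card (S \<times> (pverts G - S) \<inter> parcs G))"
    using fin by (simp add: Int_def)
  finally show ?thesis by (simp add: cut_size_def Int_commute)
qed

lemma cut_insert:
  assumes "S \<subseteq> pverts G" "x \<in> pverts G" "x \<notin> S"
  shows "int (cut_size (with_proj G) (insert x S)) =
    int (cut_size (with_proj G) S) + (\<Sum>v\<in>pverts G. adj x v) - 2 * (\<Sum>w\<in>S. adj x w)"
proof -
  let ?W = "pverts G - insert x S"
  have fin: "finite S" "finite ?W"
    using finite_subset[OF assms(1) finite_verts] finite_verts by simp_all
  have VS: "pverts G - S = insert x ?W" using assms by auto
  have "(\<Sum>v\<in>pverts G. adj x v) = (\<Sum>v\<in>insert x ?W. adj x v) + (\<Sum>v\<in>S. adj x v)"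
    unfolding VS[symmetric] using assms(1) finite_verts by (rule sum.subset_diff)
  also have "(\<Sum>v\<in>insert x ?W. adj x v) = (\<Sum>v\<in>?W. adj x v)"
    using fin no_loops'[of x x] by (subst sum.insert) auto
  finally have deg: "(\<Sum>v\<in>pverts G. adj x v) = (\<Sum>v\<in>?W. adj x v) + (\<Sum>v\<in>S. adj x v)" .
  have "int (cut_size (with_proj G) S) = (\<Sum>u\<in>S. \<Sum>v\<in>insert x ?W. adj u v)"
    by (simp only: cut_eq_sum[OF assms(1)] VS)
  also have "\<dots> = (\<Sum>u\<in>S. adj u x + (\<Sum>v\<in>?W. adj u v))"
    using fin by (intro sum.cong refl, subst sum.insert) auto
  also have "\<dots> = (\<Sum>u\<in>S. adj x u) + (\<Sum>u\<in>S. \<Sum>v\<in>?W. adj u v)"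
    by (simp only: sum.distrib adj_sym[of _ x])
  finally have "int (cut_size (with_proj G) S) = (\<Sum>u\<in>S. adj x u) + (\<Sum>u\<in>S. \<Sum>v\<in>?W. adj u v)" .
  moreover have "int (cut_size (with_proj G) (insert x S)) =
      (\<Sum>v\<in>?W. adj x v) + (\<Sum>u\<in>S. \<Sum>v\<in>?W. adj u v)"
    using assms fin by (subst cut_eq_sum) (auto simp: sum.insert)
  ultimately show ?thesis using deg by simp
qed

lemma completeI:
  assumes "\<And>u v. u \<in> pverts G \<Longrightarrow> v \<in> pverts G \<Longrightarrow> u \<noteq> v \<Longrightarrow> (u, v) \<in> parcs G"
  shows "K\<^bsub>card (pverts G)\<^esub> (with_proj G)"
proof -
  have "u \<in> pverts G \<and> v \<in> pverts G \<and> u \<noteq> v" if "(u, v) \<in> parcs G" for u v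
    using in_arcsD1[OF that] in_arcsD2[OF that] no_loops'[OF that] by simp
  then have "(u, v) \<in> parcs G \<longleftrightarrow> u \<in> pverts G \<and> v \<in> pverts G \<and> u \<noteq> v" for u v
    using assms by metis
  then have "parcs G = {(u, v). (u, v) \<in> pverts G \<times> pverts G \<and> u \<noteq> v}"
    by (simp add: set_eq_iff)
  then show ?thesis
    using finite_verts unfolding complete_digraph_pair_def by blast
qed

lemma connected_neighbour:
  assumes "Digraph_Component.connected (with_proj G)"
    and "u \<in> pverts G" "v \<in> pverts G" "u \<noteq> v"
  obtains w where "(u, w) \<in> parcs G"
proof -
  have "u \<rightarrow>\<^sup>*\<^bsub>with_proj (mk_symmetric (with_proj G))\<^esub> v"
    using assms by (simp add: Digraph_Component.connected_def strongly_connected_def)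
  then obtain w where "(u, w) \<in> parcs (mk_symmetric (with_proj G))"
    using \<open>u \<noteq> v\<close> unfolding reachable_def
    by (cases rule: converse_rtrancl_on_cases) auto
  then have "(u, w) \<in> parcs G"
    using arcs_symmetric[of w u] by (auto simp: mk_symmetric_def)
  then show thesis by (rule that)
qed

lemma odd_constant_cut_imp_complete:
  assumes conn: "Digraph_Component.connected (with_proj G)"
    and odd: "odd (card (pverts G))"
    and const: "\<And>S T. balanced (pverts G) S \<Longrightarrow> balanced (pverts G) T \<Longrightarrow>
      cut_size (with_proj G) S = cut_size (with_proj G) T"
  shows "K\<^bsub>card (pverts G)\<^esub> (with_proj G)"
proof -
  define k where "k = card (pverts G) div 2"
  have card: "card (pverts G) = 2 * k + 1"
    using odd by (simp add: k_def)
  have "(u, v) \<in> parcs G" if uv: "u \<in> pverts G" "v \<in> pverts G" "u \<noteq> v" for u v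
  proof -
    from conn uv obtain w where w: "(u, w) \<in> parcs G"
      by (rule connected_neighbour)
    let ?R = "pverts G - {u}"
    have wR: "w \<in> ?R" using in_arcsD2[OF w] no_loops'[OF w] by auto
    have cR: "card ?R = 2 * k" using uv card finite_verts by simp
    moreover have "card ?R > 0" using wR finite_verts by (auto simp: card_gt_0_iff)
    ultimately have k: "0 < k" "k < card ?R" by auto
    have "2 * (\<Sum>w\<in>T. adj u w) = (\<Sum>v\<in>pverts G. adj u v)" if T: "T \<subseteq> ?R" "card T = k" for T
    proof -
      have "finite T" using T finite_verts by (meson finite_Diff finite_subset)
      then have "balanced (pverts G) T" "balanced (pverts G) (insert u T)"
        using T uv card finite_verts by (auto simp: balanced_iff_card card_insert_if)
      then have "cut_size (with_proj G) (insert u T) = cut_size (with_proj G) T"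
        using const by blast
      moreover have "T \<subseteq> pverts G" "u \<notin> T" using T by auto
      ultimately show ?thesis using cut_insert[of T u] uv by simp
    qed
    then have "(\<Sum>w\<in>T. adj u w) = (\<Sum>v\<in>pverts G. adj u v) div 2" if "T \<subseteq> ?R" "card T = k" for T
      using that by (metis nonzero_mult_div_cancel_left zero_neq_numeral)
    then have "adj u w = adj u v"
      using k wR uv finite_verts by (intro equal_if_subset_sums_equal[of ?R k]) auto
    with w show ?thesis by simp
  qed
  then show ?thesis
    by (rule completeI)
qed

lemma even_constant_cut_rows:
  assumes even: "even (card (pverts G))"
    and const: "\<And>S T. balanced (pverts G) S \<Longrightarrow> balanced (pverts G) T \<Longrightarrow>
      cut_size (with_proj G) S = cut_size (with_proj G) T"
    and uv: "u \<in> pverts G" "v \<in> pverts G" "u \<noteq> v"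
    and xy: "x \<in> pverts G - {u, v}" "y \<in> pverts G - {u, v}"
  shows "adj u x - adj v x = adj u y - adj v y"
proof -
  define m where "m = card (pverts G) div 2 - 1"
  let ?R = "pverts G - {u, v}"
  have two: "card {u, v} = 2" using uv(3) by simp
  have "card {u, v} \<le> card (pverts G)"
    using uv by (intro card_mono) auto
  then have "2 \<le> card (pverts G)" using two by simp
  then have card: "card (pverts G) = 2 * m + 2"
    using even unfolding m_def by presburger
  have "card ?R = card (pverts G) - card {u, v}"
    using uv by (intro card_Diff_subset) auto
  then have cR: "card ?R = 2 * m"
    using two card by linarith
  moreover have "card ?R > 0" using xy finite_verts by (auto simp: card_gt_0_iff)
  ultimately have m: "0 < m" "m < card ?R" by auto
  let ?c = "((\<Sum>v\<in>pverts G. adj u v) - (\<Sum>w\<in>pverts G. adj v w)) div 2"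
  have "(\<Sum>w\<in>T. adj u w - adj v w) = ?c" if T: "T \<subseteq> ?R" "card T = m" for T
  proof -
    have "finite T" using T finite_verts by (meson finite_Diff finite_subset)
    moreover have "u \<notin> T" "v \<notin> T" using T by auto
    ultimately have "balanced (pverts G) (insert u T)" "balanced (pverts G) (insert v T)"
      using T uv card finite_verts by (auto simp: balanced_iff_card card_insert_if)
    then have "cut_size (with_proj G) (insert u T) = cut_size (with_proj G) (insert v T)"
      using const by blast
    moreover have "T \<subseteq> pverts G" using T by auto
    ultimately have "(\<Sum>v\<in>pverts G. adj u v) - (\<Sum>w\<in>pverts G. adj v w)
        = 2 * (\<Sum>w\<in>T. adj u w - adj v w)"
      using cut_insert[of T u] cut_insert[of T v] uv \<open>u \<notin> T\<close> \<open>v \<notin> T\<close>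
      by (simp add: sum_subtractf)
    then show ?thesis by simp
  qed
  then show ?thesis
    using m xy finite_verts
    by (intro equal_if_subset_sums_equal[of ?R m "\<lambda>w. adj u w - adj v w" ?c]) auto
qed

lemma even_constant_cut_imp_star_or_complete:
  assumes conn: "Digraph_Component.connected (with_proj G)"
    and even: "even (card (pverts G))"
    and const: "\<And>S T. balanced (pverts G) S \<Longrightarrow> balanced (pverts G) T \<Longrightarrow>
      cut_size (with_proj G) S = cut_size (with_proj G) T"
  shows "K\<^bsub>1,card (pverts G) - 1\<^esub> (with_proj G) \<or> K\<^bsub>card (pverts G)\<^esub> (with_proj G)"
proof -
  note rows = even_constant_cut_rows[OF even const]
  show ?thesis
  proof (cases "\<forall>u\<in>pverts G. \<forall>v\<in>pverts G. \<forall>w\<in>pverts G.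
      u \<noteq> v \<longrightarrow> w \<noteq> u \<longrightarrow> w \<noteq> v \<longrightarrow> (u, w) \<in> parcs G \<longrightarrow> (v, w) \<in> parcs G")
    case twins: True
    have "(u, v) \<in> parcs G" if uv: "u \<in> pverts G" "v \<in> pverts G" "u \<noteq> v" for u v
    proof -
      from conn uv obtain w where w: "(u, w) \<in> parcs G"
        by (rule connected_neighbour)
      then have "w \<in> pverts G" "w \<noteq> u" "(w, u) \<in> parcs G"
        using in_arcsD2[OF w] no_loops'[OF w] arcs_symmetric[OF w] by auto
      then have "w \<noteq> v \<Longrightarrow> (v, u) \<in> parcs G"
        using bspec[OF bspec[OF bspec[OF twins]], of w v u] uv by simp
      then show ?thesis
        using w arcs_symmetric[of v u] by (cases "w = v") simp_all
    qed
    then show ?thesis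
      by (intro disjI2 completeI)
  next
    case False
    then obtain u v w where uvw: "u \<in> pverts G" "v \<in> pverts G" "w \<in> pverts G"
      "u \<noteq> v" "w \<noteq> u" "w \<noteq> v" "(u, w) \<in> parcs G" "(v, w) \<notin> parcs G" by blast
    have split: "(u, y) \<in> parcs G \<and> (v, y) \<notin> parcs G" if "y \<in> pverts G - {u, v}" for y
      using rows[of u v w y] uvw that by (auto simp: of_bool_def split: if_splits)
    from conn uvw(2,1) uvw(4)[symmetric] obtain z where z: "(v, z) \<in> parcs G"
      by (rule connected_neighbour)
    have "z = u"
      using z split[of z] in_arcsD2[OF z] no_loops'[OF z] by blast
    with z have vu: "(v, u) \<in> parcs G" "(u, v) \<in> parcs G"
      using arcs_symmetric[OF z] by auto
    have centre: "(u, y) \<in> parcs G" "(y, u) \<in> parcs G" if "y \<in> pverts G" "y \<noteq> u" for y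
      using split[of y] vu that arcs_symmetric[of u y] by blast+
    have leaves: "(x, y) \<notin> parcs G" if xy: "x \<in> pverts G - {u}" "y \<in> pverts G - {u}" for x y
    proof (cases "x = y \<or> x = v \<or> y = v")
      case True
      then show ?thesis
        using xy split[of y] split[of x] no_loops'[of x y] arcs_symmetric[of x y] by blast
    next
      case False
      then show ?thesis
        using rows[of x v u y] xy uvw vu centre split[of y]
        by (auto simp: of_bool_def split: if_splits)
    qed
    have "parcs G = {u} \<times> (pverts G - {u}) \<union> (pverts G - {u}) \<times> {u}"
    proof (intro equalityI subrelI)
      fix x y assume "(x, y) \<in> parcs G"
      then show "(x, y) \<in> {u} \<times> (pverts G - {u}) \<union> (pverts G - {u}) \<times> {u}"
        using leaves[of x y] in_arcsD1[of x y] in_arcsD2[of x y] no_loops'[of x y] by auto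
    qed (use centre in auto)
    moreover have "pverts G = {u} \<union> (pverts G - {u})" "{u} \<inter> (pverts G - {u}) = {}"
      using uvw by auto
    moreover have "card {u} = 1" "card (pverts G - {u}) = card (pverts G) - 1"
      using uvw finite_verts by auto
    ultimately show ?thesis
      using finite_verts unfolding complete_bipartite_digraph_pair_def by blast
  qed
qed

lemma even_star_cut:
  assumes "K\<^bsub>1,n\<^esub> (with_proj G)" "even (card (pverts G))" "balanced (pverts G) S"
  shows "cut_size (with_proj G) S = card (pverts G) div 2"
proof -
  obtain U W where UW: "pverts G = U \<union> W" "U \<inter> W = {}" "card U = 1" "parcs G = U \<times> W \<union> W \<times> U"
    using assms(1) unfolding complete_bipartite_digraph_pair_def by blast
  then obtain c where c: "U = {c}" by (auto simp: card_1_singleton_iff)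
  have S: "S \<subseteq> pverts G" "card S = card (pverts G) div 2"
    using assms finite_verts by (auto simp: balanced_iff_card elim: evenE)
  then have cS: "card (pverts G - S) = card (pverts G) div 2"
    using assms(2) finite_verts by (auto simp: card_Diff_subset finite_subset elim: evenE)
  show ?thesis
  proof (cases "c \<in> S")
    case True
    then have "parcs G \<inter> S \<times> (pverts G - S) = {c} \<times> (pverts G - S)"
      using UW c by auto
    then show ?thesis using cS by (simp add: cut_size_def card_cartesian_product)
  next
    case False
    then have "parcs G \<inter> S \<times> (pverts G - S) = S \<times> {c}"
      using UW c S(1) by auto
    then show ?thesis using S by (simp add: cut_size_def card_cartesian_product)
  qed
qed

lemma cut_complement:
  "cut_size (with_proj G) S + cut_size (with_proj (complement G)) S
    = cut_size (Digraph_Component.union (with_proj G) (with_proj (complement G))) S"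
proof -
  interpret C: pair_graph "complement G"
    using pair_graph_axioms by (rule pair_graph_complement)
  let ?X = "S \<times> (pverts G - S)"
  have "arcs_ends (Digraph_Component.union (with_proj G) (with_proj (complement G))) \<inter> ?X
      = (parcs G \<inter> ?X) \<union> (parcs (complement G) \<inter> ?X)"
    by (auto simp: arcs_ends_conv)
  moreover have "card ((parcs G \<inter> ?X) \<union> (parcs (complement G) \<inter> ?X))
      = card (parcs G \<inter> ?X) + card (parcs (complement G) \<inter> ?X)"
  proof (rule card_Un_disjoint)
    show "(parcs G \<inter> ?X) \<inter> (parcs (complement G) \<inter> ?X) = {}"
      by (auto simp: complement_def)
  qed simp_all
  moreover have "pverts (complement G) = pverts G"
    by (simp add: complement_def)
  ultimately show ?thesis
    by (simp add: cut_size_def)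
qed

lemma rna_sum_complement:
  defines "K \<equiv> Digraph_Component.union (with_proj G) (with_proj (complement G))"
  shows "rna (with_proj G) + rna (with_proj (complement G)) \<le> rna K"
    and "rna (with_proj G) + rna (with_proj (complement G)) = rna K \<longleftrightarrow>
      (\<forall>S T. balanced (pverts G) S \<longrightarrow> balanced (pverts G) T \<longrightarrow>
        cut_size (with_proj G) S = cut_size (with_proj G) T)"
proof -
  interpret C: pair_graph "complement G"
    using pair_graph_axioms by (rule pair_graph_complement)
  have graphs: "graph (with_proj G)" "graph (with_proj (complement G))"
    by unfold_locales
  have K: "K\<^bsub>card (pverts G)\<^esub> K"
    unfolding K_def using pair_graph_axioms by (rule complete_union_complement)
  then have "graph K" by (simp add: complete_digraph_def)
  have V: "verts K = pverts G" "pverts (complement G) = pverts G"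
    by (auto simp: K_def complement_def)
  obtain R where R: "balanced (pverts G) R" "rna K = cut_size K R"
    using rna_attained[OF \<open>graph K\<close>] V by metis
  have cutK: "cut_size (with_proj G) S + cut_size (with_proj (complement G)) S = rna K"
    if "balanced (pverts G) S" for S
    using balanced_cut_complete[OF K, of S] balanced_cut_complete[OF K, of R] R that
      cut_complement[of S] V by (simp add: K_def)
  obtain S where S: "balanced (pverts G) S" "rna (with_proj G) = cut_size (with_proj G) S"
    using rna_attained[OF graphs(1)] by auto
  obtain T where T: "balanced (pverts G) T"
    "rna (with_proj (complement G)) = cut_size (with_proj (complement G)) T"
    using rna_attained[OF graphs(2)] V by auto
  have min: "cut_size (with_proj G) S \<le> cut_size (with_proj G) U"
    "cut_size (with_proj (complement G)) T \<le> cut_size (with_proj (complement G)) U"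
    if "balanced (pverts G) U" for U
    using rna_le_cut[OF graphs(1), of U] rna_le_cut[OF graphs(2), of U] S T V that by simp_all
  show "rna (with_proj G) + rna (with_proj (complement G)) \<le> rna K"
    using cutK[OF S(1)] min(2)[OF S(1)] S T by simp
  show "rna (with_proj G) + rna (with_proj (complement G)) = rna K \<longleftrightarrow>
      (\<forall>S T. balanced (pverts G) S \<longrightarrow> balanced (pverts G) T \<longrightarrow>
        cut_size (with_proj G) S = cut_size (with_proj G) T)"
  proof
    assume eq: "rna (with_proj G) + rna (with_proj (complement G)) = rna K"
    have "cut_size (with_proj G) U = cut_size (with_proj G) S" if "balanced (pverts G) U" for U
      using eq cutK[OF that] min[OF that] S T by simp
    then show "\<forall>S T. balanced (pverts G) S \<longrightarrow> balanced (pverts G) T \<longrightarrow>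
        cut_size (with_proj G) S = cut_size (with_proj G) T" by simp
  next
    assume "\<forall>S T. balanced (pverts G) S \<longrightarrow> balanced (pverts G) T \<longrightarrow>
        cut_size (with_proj G) S = cut_size (with_proj G) T"
    then have "cut_size (with_proj G) S = cut_size (with_proj G) T" using S T by blast
    then show "rna (with_proj G) + rna (with_proj (complement G)) = rna K"
      using cutK[OF T(1)] S T by simp
  qed
qed

end

theorem theorem3:
  fixes G :: "'a pair_pre_digraph" and n :: nat
  assumes "pair_graph G"
    and "Digraph_Component.connected (with_proj G)"
    and "card (pverts G) = n"
  shows "rna (with_proj G) + rna (with_proj (complement G))
           \<le> rna (Digraph_Component.union (with_proj G) (with_proj (complement G))) \<and>
         (rna (with_proj G) + rna (with_proj (complement G))
             = rna (Digraph_Component.union (with_proj G) (with_proj (complement G))) \<longleftrightarrow>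
           (K\<^bsub>1,n - 1\<^esub> (with_proj G) \<and> even n) \<or> K\<^bsub>n\<^esub> (with_proj G))"
proof -
  interpret pair_graph G by fact
  have "(\<forall>S T. balanced (pverts G) S \<longrightarrow> balanced (pverts G) T \<longrightarrow>
        cut_size (with_proj G) S = cut_size (with_proj G) T) \<longleftrightarrow>
      (K\<^bsub>1,n - 1\<^esub> (with_proj G) \<and> even n) \<or> K\<^bsub>n\<^esub> (with_proj G)" (is "?const \<longleftrightarrow> ?R")
  proof
    assume const: ?const
    show ?R
    proof (cases "even n")
      case True
      then show ?thesis
        using even_constant_cut_imp_star_or_complete[OF assms(2)] const assms(3) by blast
    next
      case False
      then show ?thesis
        using odd_constant_cut_imp_complete[OF assms(2)] const assms(3) by blast
    qed
  next
    assume ?R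
    then show ?const
      using even_star_cut balanced_cut_complete[of n "with_proj G"] assms(3) by auto
  qed
  with rna_sum_complement show ?thesis by simp
qed

end
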